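(* Let $C$ be a diamond category with countably many isomorphism classes, $\mathcal{P}$ its category of pro-objects, $\mu$ a probability measure on $\mathcal{P}/\cong$ with finite moments $M_G$, and $f_n:C/\cong\to\mathbb{R}$ a real-valued $L^1$-ordering. Suppose there exist an integer $k$, a non-decreasing function $\gamma:\mathbb{N}\to\mathbb{R}^+$ with $\lim_{t\to\infty}\gamma(t)=\infty$ and $\sum_{n=1}^\infty\frac{1}{\gamma(n)}<\infty$, and a function $E:\mathbb{N}\to\mathbb{R}^+$ such that \[ \int_{\mathcal{P}}\left|N(\mathscr{G},f_n)-\int_C f_n\,dM\right|^k d\mu(\mathscr{G})=O\!\left(\frac{E(n)^k}{\gamma(n)}\right). \] Then $\left(N(\mathscr{G},f_n)-\int_C f_n\,dM\right)/E(n)\to 0$ $\mu$-almost surely as $n\to\infty$.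
   Context: Diamond category in the sense of Sawin–Wood; $\mu$ a Borel probability measure on isomorphism classes of pro-objects (level topology) with $M_G=\int_{\mathcal{P}}\#\mathrm{Epi}(\mathscr{G},G)\,d\mu(\mathscr{G})<\infty$. $M$ is the discrete measure with $M(\{G\})=M_G$. An $L^1$-ordering is a sequence $f_n:C/\cong\to\mathbb{C}$ with $\sum_G|f_n(G)|M_G<\infty$ for each $n$; $N(\mathscr{G},f_n)=\sum_{G}f_n(G)\#\mathrm{Epi}(\mathscr{G},G)$ (defined $\mu$-a.s.).
   Formalization: The integer k is taken to be non-negative, since for negative k the hypothesis forces the quotient to diverge and the claim fails; the pro-objects are those having a maximal quotient at every level, as the level topology requires. *)

theory Defs
  imports
    "HOL-Algebra.Lattice"
    "HOL-Probability.Probability"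
    "HOL-Library.Landau_Symbols"
begin

section \<open>Small categories\<close>

record ('o, 'a) cat =
  Obj :: "'o set"
  Arr :: "'a set"
  Dom :: "'a \<Rightarrow> 'o"
  Cod :: "'a \<Rightarrow> 'o"
  Id :: "'o \<Rightarrow> 'a"
  Comp :: "'a \<Rightarrow> 'a \<Rightarrow> 'a"  (infixl \<open>\<cdot>\<index>\<close> 70)

definition Hom :: "('o, 'a) cat \<Rightarrow> 'o \<Rightarrow> 'o \<Rightarrow> 'a set" where
  "Hom C a b = {f \<in> Arr C. Dom C f = a \<and> Cod C f = b}"

locale category =
  fixes C :: "('o, 'a) cat" (structure)
  assumes Dom_Obj: "f \<in> Arr C \<Longrightarrow> Dom C f \<in> Obj C"
    and Cod_Obj: "f \<in> Arr C \<Longrightarrow> Cod C f \<in> Obj C"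
    and Id_Hom: "a \<in> Obj C \<Longrightarrow> Id C a \<in> Hom C a a"
    and Comp_Hom: "\<lbrakk>f \<in> Hom C a b; g \<in> Hom C b c\<rbrakk> \<Longrightarrow> g \<cdot> f \<in> Hom C a c"
    and Comp_Id: "f \<in> Hom C a b \<Longrightarrow> f \<cdot> Id C a = f"
    and Id_Comp: "f \<in> Hom C a b \<Longrightarrow> Id C b \<cdot> f = f"
    and Comp_assoc: "\<lbrakk>f \<in> Hom C a b; g \<in> Hom C b c; h \<in> Hom C c d\<rbrakk>
        \<Longrightarrow> (h \<cdot> g) \<cdot> f = h \<cdot> (g \<cdot> f)"

definition is_epi :: "('o, 'a) cat \<Rightarrow> 'a \<Rightarrow> bool" where
  "is_epi C f \<longleftrightarrow> f \<in> Arr C \<and>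
     (\<forall>b. \<forall>g\<in>Hom C (Cod C f) b. \<forall>h\<in>Hom C (Cod C f) b. g \<cdot>\<^bsub>C\<^esub> f = h \<cdot>\<^bsub>C\<^esub> f \<longrightarrow> g = h)"

definition is_iso :: "('o, 'a) cat \<Rightarrow> 'a \<Rightarrow> bool" where
  "is_iso C f \<longleftrightarrow> f \<in> Arr C \<and>
     (\<exists>g\<in>Hom C (Cod C f) (Dom C f). g \<cdot>\<^bsub>C\<^esub> f = Id C (Dom C f) \<and> f \<cdot>\<^bsub>C\<^esub> g = Id C (Cod C f))"

definition Epi :: "('o, 'a) cat \<Rightarrow> 'o \<Rightarrow> 'o \<Rightarrow> 'a set" where
  "Epi C a b = {f \<in> Hom C a b. is_epi C f}"

definition Aut :: "('o, 'a) cat \<Rightarrow> 'o \<Rightarrow> 'a set" where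
  "Aut C a = {f \<in> Hom C a a. is_iso C f}"

definition iso_rel :: "('o, 'a) cat \<Rightarrow> ('o \<times> 'o) set" where
  "iso_rel C = {(a, b). a \<in> Obj C \<and> b \<in> Obj C \<and> (\<exists>f\<in>Hom C a b. is_iso C f)}"

definition iso_classes :: "('o, 'a) cat \<Rightarrow> 'o set set" where
  "iso_classes C = Obj C // iso_rel C"

definition rep :: "'o set \<Rightarrow> 'o" where
  "rep c = (SOME a. a \<in> c)"


section \<open>Quotients, levels and diamond categories (Sawin--Wood)\<close>

definition quotients :: "('o, 'a) cat \<Rightarrow> 'o \<Rightarrow> 'a set" where
  "quotients C G = {p \<in> Arr C. Dom C p = G \<and> is_epi C p}"

text \<open>Both \<open>p\<close> and \<open>q\<close> are quotients of the same object; the quotient \<open>p\<close> lies below \<open>q\<close>.\<close>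

definition quot_le :: "('o, 'a) cat \<Rightarrow> 'a \<Rightarrow> 'a \<Rightarrow> bool" where
  "quot_le C p q \<longleftrightarrow> (\<exists>h\<in>Epi C (Cod C q) (Cod C p). p = h \<cdot>\<^bsub>C\<^esub> q)"

definition quot_iso :: "('o, 'a) cat \<Rightarrow> 'o \<Rightarrow> ('a \<times> 'a) set" where
  "quot_iso C G = {(p, q). p \<in> quotients C G \<and> q \<in> quotients C G \<and>
     (\<exists>h\<in>Hom C (Cod C p) (Cod C q). is_iso C h \<and> q = h \<cdot>\<^bsub>C\<^esub> p)}"

definition quotient_order :: "('o, 'a) cat \<Rightarrow> 'o \<Rightarrow> 'a set gorder" where
  "quotient_order C G =
     \<lparr>carrier = quotients C G // quot_iso C G, eq = (=),
      le = (\<lambda>A B. \<exists>p\<in>A. \<exists>q\<in>B. quot_le C p q)\<rparr>"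

definition modular_lattice :: "'b gorder \<Rightarrow> bool" where
  "modular_lattice L \<longleftrightarrow> Lattice.lattice L \<and>
     (\<forall>x\<in>carrier L. \<forall>y\<in>carrier L. \<forall>z\<in>carrier L.
        x \<sqsubseteq>\<^bsub>L\<^esub> z \<longrightarrow> x \<squnion>\<^bsub>L\<^esub> (y \<sqinter>\<^bsub>L\<^esub> z) = (x \<squnion>\<^bsub>L\<^esub> y) \<sqinter>\<^bsub>L\<^esub> z)"

definition simple_epi :: "('o, 'a) cat \<Rightarrow> 'a \<Rightarrow> bool" where
  "simple_epi C f \<longleftrightarrow> is_epi C f \<and> \<not> is_iso C f \<and>
     (\<forall>b. \<forall>g\<in>Epi C (Dom C f) b. \<forall>h\<in>Epi C b (Cod C f).
        f = h \<cdot>\<^bsub>C\<^esub> g \<longrightarrow> is_iso C g \<or> is_iso C h)"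

definition minimal_obj :: "('o, 'a) cat \<Rightarrow> 'o \<Rightarrow> bool" where
  "minimal_obj C G \<longleftrightarrow> G \<in> Obj C \<and> (\<forall>p\<in>quotients C G. is_iso C p)"

definition downward_closed :: "('o, 'a) cat \<Rightarrow> 'o set \<Rightarrow> bool" where
  "downward_closed C W \<longleftrightarrow> (\<forall>G\<in>W. \<forall>p\<in>quotients C G. Cod C p \<in> W)"

definition join_closed :: "('o, 'a) cat \<Rightarrow> 'o set \<Rightarrow> bool" where
  "join_closed C W \<longleftrightarrow>
     (\<forall>G\<in>Obj C. \<forall>p\<in>quotients C G. \<forall>q\<in>quotients C G. \<forall>r\<in>quotients C G.
        Cod C p \<in> W \<and> Cod C q \<in> W \<and>
        least (quotient_order C G) (quot_iso C G `` {r})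
          (Upper (quotient_order C G) {quot_iso C G `` {p}, quot_iso C G `` {q}})
        \<longrightarrow> Cod C r \<in> W)"

text \<open>
  Sets of isomorphism classes of objects are represented by isomorphism-closed sets of objects;
  isomorphism-closedness is part of \<^const>\<open>downward_closed\<close>, as isomorphisms are epimorphisms.
\<close>

definition formation :: "('o, 'a) cat \<Rightarrow> 'o set \<Rightarrow> bool" where
  "formation C W \<longleftrightarrow> W \<subseteq> Obj C \<and> downward_closed C W \<and> join_closed C W \<and>
     (\<forall>G. minimal_obj C G \<longrightarrow> G \<in> W)"

definition generated_formation :: "('o, 'a) cat \<Rightarrow> 'o set \<Rightarrow> 'o set" where
  "generated_formation C S = \<Inter>{W. formation C W \<and> S \<subseteq> W}"

definition level :: "('o, 'a) cat \<Rightarrow> 'o set \<Rightarrow> bool" where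
  "level C W \<longleftrightarrow> (\<exists>S. finite S \<and> S \<subseteq> Obj C \<and> W = generated_formation C S)"

locale diamond_category = category C for C :: "('o, 'a) cat" (structure) +
  assumes finite_quotients: "G \<in> Obj C \<Longrightarrow> finite (carrier (quotient_order C G))"
    and modular_quotients: "G \<in> Obj C \<Longrightarrow> modular_lattice (quotient_order C G)"
    and finite_Aut: "G \<in> Obj C \<Longrightarrow> finite (Aut C G)"
    and finite_simple_epi: "\<lbrakk>level C W; G \<in> W\<rbrakk>
        \<Longrightarrow> finite {c \<in> iso_classes C. \<exists>H\<in>c. H \<in> W \<and> (\<exists>f\<in>Epi C H G. simple_epi C f)}"


section \<open>The category of pro-objects\<close>

text \<open>
  A pro-object is a functor \<open>i \<mapsto> X i\<close> from a small cofiltered category to \<open>C\<close>, and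
  \<open>Hom (X, Y) = lim_j colim_i Hom_C (X i, Y j)\<close>.
  The types of objects and arrows of the index categories remain type variables, which play the
  role of the universe from which index categories are taken.
\<close>

record ('i, 'j, 'o, 'a) pro_obj =
  Idx :: "('i, 'j) cat"
  Ob :: "'i \<Rightarrow> 'o"
  Tr :: "'j \<Rightarrow> 'a"

definition cofiltered :: "('i, 'j) cat \<Rightarrow> bool" where
  "cofiltered J \<longleftrightarrow> category J \<and> Obj J \<noteq> {} \<and>
     (\<forall>a\<in>Obj J. \<forall>b\<in>Obj J. \<exists>c. Hom J c a \<noteq> {} \<and> Hom J c b \<noteq> {}) \<and>
     (\<forall>a\<in>Obj J. \<forall>b\<in>Obj J. \<forall>u\<in>Hom J a b. \<forall>v\<in>Hom J a b.
        \<exists>c. \<exists>w\<in>Hom J c a. u \<cdot>\<^bsub>J\<^esub> w = v \<cdot>\<^bsub>J\<^esub> w)"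

definition is_functor ::
  "('i, 'j) cat \<Rightarrow> ('o, 'a) cat \<Rightarrow> ('i \<Rightarrow> 'o) \<Rightarrow> ('j \<Rightarrow> 'a) \<Rightarrow> bool" where
  "is_functor J C F T \<longleftrightarrow>
     (\<forall>i\<in>Obj J. F i \<in> Obj C \<and> T (Id J i) = Id C (F i)) \<and>
     (\<forall>i j. \<forall>u\<in>Hom J i j. T u \<in> Hom C (F i) (F j)) \<and>
     (\<forall>i j k. \<forall>u\<in>Hom J i j. \<forall>v\<in>Hom J j k. T (v \<cdot>\<^bsub>J\<^esub> u) = T v \<cdot>\<^bsub>C\<^esub> T u)"

definition pro_object :: "('o, 'a) cat \<Rightarrow> ('i, 'j, 'o, 'a) pro_obj \<Rightarrow> bool" where
  "pro_object C X \<longleftrightarrow> cofiltered (Idx X) \<and> is_functor (Idx X) C (Ob X) (Tr X)"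

text \<open>The set \<open>colim_i Hom_C (X i, G)\<close> consists of classes of pairs \<open>(i, f)\<close> with \<open>f : X i \<rightarrow> G\<close>.\<close>

definition germs :: "('o, 'a) cat \<Rightarrow> ('i, 'j, 'o, 'a) pro_obj \<Rightarrow> 'o \<Rightarrow> ('i \<times> 'a) set" where
  "germs C X G = {(i, f). i \<in> Obj (Idx X) \<and> f \<in> Hom C (Ob X i) G}"

definition germ_rel ::
  "('o, 'a) cat \<Rightarrow> ('i, 'j, 'o, 'a) pro_obj \<Rightarrow> 'o \<Rightarrow> (('i \<times> 'a) \<times> ('i \<times> 'a)) set" where
  "germ_rel C X G = {((i, f), (j, g)). (i, f) \<in> germs C X G \<and> (j, g) \<in> germs C X G \<and>
     (\<exists>k. \<exists>u\<in>Hom (Idx X) k i. \<exists>v\<in>Hom (Idx X) k j. f \<cdot>\<^bsub>C\<^esub> Tr X u = g \<cdot>\<^bsub>C\<^esub> Tr X v)}"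

definition colim_Hom ::
  "('o, 'a) cat \<Rightarrow> ('i, 'j, 'o, 'a) pro_obj \<Rightarrow> 'o \<Rightarrow> ('i \<times> 'a) set set" where
  "colim_Hom C X G = germs C X G // germ_rel C X G"

definition postcomp ::
  "('o, 'a) cat \<Rightarrow> ('i, 'j, 'o, 'a) pro_obj \<Rightarrow> 'a \<Rightarrow> ('i \<times> 'a) set \<Rightarrow> ('i \<times> 'a) set" where
  "postcomp C X g c = germ_rel C X (Cod C g) `` ((\<lambda>(i, f). (i, g \<cdot>\<^bsub>C\<^esub> f)) ` c)"

text \<open>A family in \<open>lim_j colim_i Hom_C (X i, Y j)\<close> takes the dummy value \<open>{}\<close> off the index set.\<close>

definition pro_Hom ::
  "('o, 'a) cat \<Rightarrow> ('i, 'j, 'o, 'a) pro_obj \<Rightarrow> ('i, 'j, 'o, 'a) pro_obj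
     \<Rightarrow> ('i \<Rightarrow> ('i \<times> 'a) set) set" where
  "pro_Hom C X Y = {\<phi>.
     (\<forall>j\<in>Obj (Idx Y). \<phi> j \<in> colim_Hom C X (Ob Y j)) \<and>
     (\<forall>j. j \<notin> Obj (Idx Y) \<longrightarrow> \<phi> j = {}) \<and>
     (\<forall>u\<in>Arr (Idx Y). postcomp C X (Tr Y u) (\<phi> (Dom (Idx Y) u)) = \<phi> (Cod (Idx Y) u))}"

definition pro_Id ::
  "('o, 'a) cat \<Rightarrow> ('i, 'j, 'o, 'a) pro_obj \<Rightarrow> 'i \<Rightarrow> ('i \<times> 'a) set" where
  "pro_Id C X j =
     (if j \<in> Obj (Idx X) then germ_rel C X (Ob X j) `` {(j, Id C (Ob X j))} else {})"

text \<open>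
  If the component \<open>\<psi> k\<close> is represented by \<open>g : Y j \<rightarrow> Z k\<close>, then the component at \<open>k\<close> of the
  composite of \<open>\<psi>\<close> with \<open>\<phi> : X \<rightarrow> Y\<close> is \<open>g\<close> composed with \<open>\<phi> j\<close>; the union ranges over
  all representatives, which yield the same class.
\<close>

definition pro_Comp ::
  "('o, 'a) cat \<Rightarrow> ('i, 'j, 'o, 'a) pro_obj
     \<Rightarrow> ('i \<Rightarrow> ('i \<times> 'a) set) \<Rightarrow> ('i \<Rightarrow> ('i \<times> 'a) set) \<Rightarrow> 'i \<Rightarrow> ('i \<times> 'a) set" where
  "pro_Comp C X \<psi> \<phi> k = (\<Union>(j, g)\<in>\<psi> k. postcomp C X g (\<phi> j))"

type_synonym ('i, 'j, 'o, 'a) pro_arr =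
  "('i, 'j, 'o, 'a) pro_obj \<times> ('i \<Rightarrow> ('i \<times> 'a) set) \<times> ('i, 'j, 'o, 'a) pro_obj"

definition Pro ::
  "('o, 'a) cat \<Rightarrow> (('i, 'j, 'o, 'a) pro_obj, ('i, 'j, 'o, 'a) pro_arr) cat" where
  "Pro C =
     \<lparr>Obj = {X. pro_object C X},
      Arr = {(X, \<phi>, Y). pro_object C X \<and> pro_object C Y \<and> \<phi> \<in> pro_Hom C X Y},
      Dom = (\<lambda>(X, \<phi>, Y). X),
      Cod = (\<lambda>(X, \<phi>, Y). Y),
      Id = (\<lambda>X. (X, pro_Id C X, X)),
      Comp = (\<lambda>(Y', \<psi>, Z) (X, \<phi>, Y). (X, pro_Comp C X \<psi> \<phi>, Z))\<rparr>"

text \<open>An object of \<open>C\<close> as a pro-object, indexed by a category with one object and one arrow.\<close>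

definition const_pro :: "('o, 'a) cat \<Rightarrow> 'o \<Rightarrow> ('i, 'j, 'o, 'a) pro_obj" where
  "const_pro C G =
     \<lparr>Idx = \<lparr>Obj = {undefined}, Arr = {undefined}, Dom = (\<lambda>_. undefined), Cod = (\<lambda>_. undefined),
             Id = (\<lambda>_. undefined), Comp = (\<lambda>_ _. undefined)\<rparr>,
      Ob = (\<lambda>_. G), Tr = (\<lambda>_. Id C G)\<rparr>"

abbreviation pro_Epi ::
  "('o, 'a) cat \<Rightarrow> ('i, 'j, 'o, 'a) pro_obj \<Rightarrow> 'o \<Rightarrow> ('i, 'j, 'o, 'a) pro_arr set" where
  "pro_Epi C X G \<equiv> Epi (Pro C) X (const_pro C G)"


section \<open>The level topology\<close>

text \<open>
  \<open>F\<close> is the maximal quotient of \<open>X\<close> among quotients in \<open>W\<close>, usually written \<open>X\<close> with superscript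
  \<open>W\<close>. It is unique up to isomorphism, but need not exist in \<open>C\<close> for a general pro-object \<open>X\<close>
  (for instance an infinite power of a nontrivial finite group). As in Sawin--Wood, only pro-objects having
  such quotients at all levels (small pro-objects) are points of the space.
\<close>

definition level_quotient ::
  "('o, 'a) cat \<Rightarrow> 'o set \<Rightarrow> ('i, 'j, 'o, 'a) pro_obj \<Rightarrow> 'o \<Rightarrow> bool" where
  "level_quotient C W X F \<longleftrightarrow> F \<in> W \<and>
     (\<exists>p\<in>pro_Epi C X F. \<forall>G\<in>W. \<forall>q\<in>pro_Epi C X G. quot_le (Pro C) q p)"

definition small_pro :: "('o, 'a) cat \<Rightarrow> ('i, 'j, 'o, 'a) pro_obj set" where
  "small_pro C = {X \<in> Obj (Pro C). \<forall>W. level C W \<longrightarrow> (\<exists>F. level_quotient C W X F)}"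

definition pro_classes :: "('o, 'a) cat \<Rightarrow> ('i, 'j, 'o, 'a) pro_obj set set" where
  "pro_classes C = small_pro C // iso_rel (Pro C)"

definition level_topology :: "('o, 'a) cat \<Rightarrow> ('i, 'j, 'o, 'a) pro_obj set topology" where
  "level_topology C = topology_generated_by
     {U. \<exists>W F. level C W \<and> F \<in> W \<and> U = {x \<in> pro_classes C. \<exists>X\<in>x. level_quotient C W X F}}"

definition level_borel :: "('o, 'a) cat \<Rightarrow> ('i, 'j, 'o, 'a) pro_obj set measure" where
  "level_borel C = sigma (pro_classes C) {U. openin (level_topology C) U}"


section \<open>Moments and orderings\<close>

text \<open>\<open>moment C \<mu> c\<close> is \<open>M_G\<close> for \<open>G\<close> in the isomorphism class \<open>c\<close>.\<close>

definition moment ::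
  "('o, 'a) cat \<Rightarrow> ('i, 'j, 'o, 'a) pro_obj set measure \<Rightarrow> 'o set \<Rightarrow> ennreal" where
  "moment C \<mu> c = (\<integral>\<^sup>+x. emeasure (count_space UNIV) (pro_Epi C (rep x) (rep c)) \<partial>\<mu>)"

definition moment_measure ::
  "('o, 'a) cat \<Rightarrow> ('i, 'j, 'o, 'a) pro_obj set measure \<Rightarrow> 'o set measure" where
  "moment_measure C \<mu> = density (count_space (iso_classes C)) (moment C \<mu>)"

definition L1_ordering ::
  "('o, 'a) cat \<Rightarrow> ('i, 'j, 'o, 'a) pro_obj set measure
     \<Rightarrow> (nat \<Rightarrow> 'o set \<Rightarrow> 'b::real_normed_vector) \<Rightarrow> bool" where
  "L1_ordering C \<mu> f \<longleftrightarrow>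
     (\<forall>n. (\<integral>\<^sup>+c. ennreal (norm (f n c)) * moment C \<mu> c \<partial>count_space (iso_classes C)) < \<infinity>)"

text \<open>
  The sets of epimorphisms counted here are finite, as \<open>rep x\<close> is a small pro-object. The sum
  converges absolutely for almost every \<open>x\<close> if \<open>f\<close> is integrable for \<^const>\<open>moment_measure\<close>.
\<close>

definition counting ::
  "('o, 'a) cat \<Rightarrow> ('i, 'j, 'o, 'a) pro_obj set \<Rightarrow> ('o set \<Rightarrow> 'b::real_normed_algebra_1) \<Rightarrow> 'b"
  where
  "counting C x f = (\<Sum>\<^sub>\<infinity>c\<in>iso_classes C. f c * of_nat (card (pro_Epi C (rep x) (rep c))))"

end

(* Markov's inequality and Borel-Cantelli in integrated form: the k-th absolute moments of the
   normalised errors are O(1/gamma(n)), hence summable, so by monotone convergence the series of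
   their k-th powers converges almost surely and its terms tend to 0. *)

theory Submission
  imports Defs
begin

lemma AE_tendsto_zero_if_summable_moments:
  fixes Y :: "nat \<Rightarrow> 'a \<Rightarrow> real"
  assumes k: "k > 0"
    and int: "\<forall>\<^sub>F n in sequentially. integrable M (\<lambda>x. \<bar>Y n x\<bar> ^ k)"
    and sum: "summable (\<lambda>n. \<integral>x. \<bar>Y n x\<bar> ^ k \<partial>M)"
  shows "AE x in M. (\<lambda>n. Y n x) \<longlonglongrightarrow> 0"
proof -
  \<comment> \<open>The first N indices are discarded: if integrability fails there, the Bochner
    integral takes its default value 0 and carries no information. A shift does not affect the
    limit.\<close>
  obtain N where N: "\<And>n. integrable M (\<lambda>x. \<bar>Y (n + N) x\<bar> ^ k)"
    using int unfolding eventually_sequentially by (metis le_add2)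
  have meas: "(\<lambda>x. ennreal (\<bar>Y (n + N) x\<bar> ^ k)) \<in> borel_measurable M" for n
    using measurable_compose[OF borel_measurable_integrable[OF N] measurable_ennreal] .
  have "(\<integral>\<^sup>+x. (\<Sum>n. ennreal (\<bar>Y (n + N) x\<bar> ^ k)) \<partial>M)
      = (\<Sum>n. \<integral>\<^sup>+x. ennreal (\<bar>Y (n + N) x\<bar> ^ k) \<partial>M)"
    by (intro nn_integral_suminf meas)
  also have "\<dots> = (\<Sum>n. ennreal (\<integral>x. \<bar>Y (n + N) x\<bar> ^ k \<partial>M))"
    using N by (intro suminf_cong nn_integral_eq_integral) auto
  \<comment> \<open>The terms are nonnegative, so summability of the real series makes its
    \<open>ennreal\<close> sum finite.\<close>
  also have "\<dots> \<noteq> \<infinity>"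
    using summable_ignore_initial_segment[OF sum, of N]
    by (subst suminf_ennreal2) auto
  finally have fin: "(\<integral>\<^sup>+x. (\<Sum>n. ennreal (\<bar>Y (n + N) x\<bar> ^ k)) \<partial>M) \<noteq> \<infinity>" .
  have "(\<lambda>x. \<Sum>n. ennreal (\<bar>Y (n + N) x\<bar> ^ k)) \<in> borel_measurable M"
    by (intro borel_measurable_suminf_order meas)
  from nn_integral_PInf_AE[OF this fin] show ?thesis
  proof eventually_elim
    case (elim x)
    then have "summable (\<lambda>n. \<bar>Y (n + N) x\<bar> ^ k)"
      by (intro summable_suminf_not_top) auto
    then have "(\<lambda>n. \<bar>Y n x\<bar> ^ k) \<longlonglongrightarrow> 0"
      by (rule LIMSEQ_offset[where f = "\<lambda>n. \<bar>Y n x\<bar> ^ k", OF summable_LIMSEQ_zero])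
    \<comment> \<open>Continuity of the k-th root at 0 removes the power. Cancelling it needs k > 0,
      since \<open>root 0\<close> is constantly 0 by convention.\<close>
    then have "(\<lambda>n. root k (\<bar>Y n x\<bar> ^ k)) \<longlonglongrightarrow> root k 0"
      by (rule tendsto_real_root)
    then show ?case
      using k by (simp add: real_root_power_cancel tendsto_rabs_zero_iff)
  qed
qed

text \<open>Dividing by \<open>E n\<close> divides the k-th moment by \<open>E n ^ k\<close>, which
  leaves a bound by a multiple of \<open>1 / \<gamma> n\<close>, so the previous lemma applies to
  \<open>Z n x / E n\<close>.\<close>

lemma AE_tendsto_zero_if_moments_bigo:
  fixes Z :: "nat \<Rightarrow> 'a \<Rightarrow> real" and \<gamma> E :: "nat \<Rightarrow> real"
  assumes "prob_space M"
    and \<gamma>: "filterlim \<gamma> at_top sequentially" "summable (\<lambda>n. 1 / \<gamma> n)"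
    and E: "\<And>n. E n > 0"
    and int: "\<forall>\<^sub>F n in sequentially. integrable M (\<lambda>x. \<bar>Z n x\<bar> ^ k)"
    and bigo: "(\<lambda>n. \<integral>x. \<bar>Z n x\<bar> ^ k \<partial>M) \<in> O(\<lambda>n. E n ^ k / \<gamma> n)"
  shows "AE x in M. (\<lambda>n. Z n x / E n) \<longlonglongrightarrow> 0"
proof -
  interpret prob_space M by fact
  obtain B where B: "\<forall>\<^sub>F n in sequentially.
      norm (\<integral>x. \<bar>Z n x\<bar> ^ k \<partial>M) \<le> B * norm (E n ^ k / \<gamma> n)"
    using landau_o.bigE[OF bigo] by blast
  have bound: "\<forall>\<^sub>F n in sequentially. norm (\<integral>x. \<bar>Z n x / E n\<bar> ^ k \<partial>M) \<le> B * (1 / \<gamma> n)"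
    using B filterlim_at_top_dense[THEN iffD1, OF \<gamma>(1), rule_format, of 0]
  proof eventually_elim
    case (elim n)
    have "(\<integral>x. \<bar>Z n x / E n\<bar> ^ k \<partial>M) = (\<integral>x. \<bar>Z n x\<bar> ^ k \<partial>M) / E n ^ k"
      using E[of n] by (simp add: power_divide)
    then show ?case
      using elim E[of n] by (simp add: pos_divide_le_eq)
  qed
  have sum: "summable (\<lambda>n. \<integral>x. \<bar>Z n x / E n\<bar> ^ k \<partial>M)"
    using bound summable_mult[OF \<gamma>(2)] by (rule summable_comparison_test_ev)
  have "k > 0"
  proof (rule ccontr)
    \<comment> \<open>The zeroth moments all equal 1, hence are not summable.\<close>
    assume "\<not> k > 0"
    then have "summable (\<lambda>n::nat. 1::real)"
      using sum by (simp add: prob_space)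
    then show False
      by (simp add: summable_const_iff)
  qed
  moreover have "\<forall>\<^sub>F n in sequentially. integrable M (\<lambda>x. \<bar>Z n x / E n\<bar> ^ k)"
    using int by eventually_elim (simp add: power_divide)
  ultimately show ?thesis
    using sum by (intro AE_tendsto_zero_if_summable_moments)
qed

text \<open>The O-bound is understood to include finiteness of the moments for large n. A Bochner
  integral cannot express this by its value, so it is stated as eventual integrability.\<close>

theorem mainTheorem7:
  fixes C :: "('o, 'a) cat"
    and \<mu> :: "('i, 'j, 'o, 'a) pro_obj set measure"
    and f :: "nat \<Rightarrow> 'o set \<Rightarrow> real"
    and k :: nat
    and \<gamma> E :: "nat \<Rightarrow> real"
  assumes "diamond_category C"
    and "countable (iso_classes C)"
    and "prob_space \<mu>"
    and "sets \<mu> = sets (level_borel C)"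
    and "\<And>c. c \<in> iso_classes C \<Longrightarrow> moment C \<mu> c < \<infinity>"
    and "L1_ordering C \<mu> f"
    and "\<And>n. \<gamma> n > 0"
    and "mono \<gamma>"
    and "filterlim \<gamma> at_top sequentially"
    and "summable (\<lambda>n. 1 / \<gamma> (Suc n))"
    and "\<And>n. E n > 0"
    and "\<forall>\<^sub>F n in sequentially.
           integrable \<mu> (\<lambda>x. \<bar>counting C x (f n) - (\<integral>c. f n c \<partial>moment_measure C \<mu>)\<bar> ^ k)"
    and "(\<lambda>n. \<integral>x. \<bar>counting C x (f n) - (\<integral>c. f n c \<partial>moment_measure C \<mu>)\<bar> ^ k \<partial>\<mu>)
           \<in> O(\<lambda>n. E n ^ k / \<gamma> n)"
  shows "AE x in \<mu>.
           (\<lambda>n. (counting C x (f n) - (\<integral>c. f n c \<partial>moment_measure C \<mu>)) / E n) \<longlonglongrightarrow> 0"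
  \<comment> \<open>The given series starts at \<open>\<gamma> 1\<close>; adding the term at 0
    preserves summability. Here \<open>Z n\<close> is the centred count.\<close>
  using assms(3,9) assms(10)[THEN summable_Suc_iff[THEN iffD1]] assms(11-13)
  by (rule AE_tendsto_zero_if_moments_bigo)

end
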